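(* Let $\alpha>0$ be a non-integer real number, $m=\lceil\alpha\rceil$, $n\in\mathbb{N}$, let $a\neq0$ be a real number, and let $x>a$. Then $${}_aI_x^{\alpha}\,x^{2n}\ln(x)=\frac{x^{2n+\alpha}(x-a)^{\alpha}}{a^{\alpha}\,\Gamma(1+\alpha)}\Biggl(F_{21}\left(\alpha,\alpha+2n+1;\alpha+1;\frac{a-x}{a}\right)\bigl(\ln(x)-\Psi(\alpha+2n+1)\bigr)+\alpha\sum_{k=0}^{\infty}\frac{(\alpha+2n+1)_k\,\Psi(\alpha+2n+k+1)\,(a-x)^k}{(\alpha+k)\,a^k\,k!}\Biggr),$$ and $${}_a^{C}D_x^{\alpha}\,x^{2n}\ln(x)=\frac{\Gamma(2n+1)\,x^{2n-\alpha}(x-a)^{m-\alpha}}{a^{m-\alpha}\,\Gamma(1+m-\alpha)}\Biggl(F_{21}\left(m-\alpha,2n-\alpha+1;m-\alpha+1;\frac{a-x}{a}\right)\left(\frac{\ln(x)-\Psi(2n-\alpha+1)}{\Gamma(2n-m+1)}+m!\sum_{r=1}^{m}\frac{(-1)^{r-1}}{r\,(m-r)!\,\Gamma(2n-m+r+1)}\right)+\frac{m-\alpha}{\Gamma(2n-m+1)}\sum_{k=0}^{\infty}\frac{(2n-\alpha+1)_k\,\Psi(2n-\alpha+k+1)}{(m-\alpha+k)\,a^k\,k!}(a-x)^k\Biggr).$$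
   Context: Throughout, $\alpha>0$ is a non-integer real number and $m=\lceil\alpha\rceil$. For a function $f$ and $x>a$: the left-sided Riemann-Liouville fractional integral of order $\alpha$ is ${}_aI_x^{\alpha}f(x)=\frac{1}{\Gamma(\alpha)}\int_a^x(x-\tau)^{\alpha-1}f(\tau)\,d\tau$; the left-sided Caputo fractional derivative of order $\alpha$ is ${}_a^{C}D_x^{\alpha}f(x)=\frac{1}{\Gamma(m-\alpha)}\int_a^x(x-\tau)^{m-\alpha-1}f^{(m)}(\tau)\,d\tau$. Notation such as ${}_aI_x^{\alpha}\,x^{2n}\ln(x)$ means the operator applied to the function $\tau\mapsto\tau^{2n}\ln(\tau)$, evaluated at $x$. $\Gamma$ is the Gamma function and $\Psi=\Gamma'/\Gamma$ is its logarithmic derivative. $(c)_k=c(c+1)\cdots(c+k-1)$ is the Pochhammer symbol, and $F_{21}(b,c;d;z)$ denotes the Gauss hypergeometric function (hypergeometric series) ${}_2F_1$, with series $\sum_{k=0}^{\infty}\frac{(b)_k(c)_k}{(d)_k}\frac{z^k}{k!}$.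
   Formalization: Each identity is proved for x≠0 where its F21 series and its Ψ series converge (always if |x-a|<|a|); for |x-a|>|a| the Ψ series diverges and the formula is undefined. For negative a, ln and non-integer powers are principal complex branches. *)

theory Defs
  imports "HOL-Analysis.Analysis" "HOL-Real_Asymp.Real_Asymp"
begin

text \<open>
  The functions are complex-valued functions of a real variable: for a negative lower limit
  \<open>a\<close>, both the logarithm and the non-integer powers in the formulas are only meaningful
  as principal branches of complex functions. The weights of the operators are powers of
  the nonnegative real \<open>x - t\<close>, hence real.
\<close>

definition RL_integral :: "real \<Rightarrow> real \<Rightarrow> (real \<Rightarrow> complex) \<Rightarrow> real \<Rightarrow> complex" where
  "RL_integral \<alpha> a f x =
     1 / of_real (Gamma \<alpha>) * integral {a..x} (\<lambda>t. of_real ((x - t) powr (\<alpha> - 1)) * f t)"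

text \<open>
  The derivative is the one with respect to the real variable. The complex derivative would not
  do for \<open>Ln\<close>, which is discontinuous in the complex plane at every negative real
  although its restriction to the negative reals is smooth.
\<close>

definition nth_vector_derivative :: "nat \<Rightarrow> (real \<Rightarrow> complex) \<Rightarrow> real \<Rightarrow> complex" where
  "nth_vector_derivative m f = ((\<lambda>g t. vector_derivative g (at t)) ^^ m) f"

definition Caputo_derivative :: "real \<Rightarrow> real \<Rightarrow> (real \<Rightarrow> complex) \<Rightarrow> real \<Rightarrow> complex" where
  "Caputo_derivative \<alpha> a f x =
     (let m = nat \<lceil>\<alpha>\<rceil> in
        1 / of_real (Gamma (of_nat m - \<alpha>)) *
        integral {a..x} (\<lambda>t. of_real ((x - t) powr (of_nat m - \<alpha> - 1)) *
                              nth_vector_derivative m f t))"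

definition F21_term :: "real \<Rightarrow> real \<Rightarrow> real \<Rightarrow> real \<Rightarrow> nat \<Rightarrow> real" where
  "F21_term b c d z k = pochhammer b k * pochhammer c k / pochhammer d k * (z ^ k / fact k)"

definition F21 :: "real \<Rightarrow> real \<Rightarrow> real \<Rightarrow> real \<Rightarrow> real" where
  "F21 b c d z = (\<Sum>k. F21_term b c d z k)"

lemma F21_term_eq_fps_hypergeo: "F21_term b c d z k = fps_nth (fps_hypergeo [b, c] [d] 1) k * z ^ k"
  by (simp add: F21_term_def)

lemma F21_eq_eval_fps: "F21 b c d z = eval_fps (fps_hypergeo [b, c] [d] 1) z"
  by (simp add: F21_def F21_term_eq_fps_hypergeo eval_fps_def)

text \<open>The second kind of series in the formulas, which carries digamma values.\<close>

definition Psi_term :: "real \<Rightarrow> real \<Rightarrow> real \<Rightarrow> real \<Rightarrow> nat \<Rightarrow> real" where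
  "Psi_term b c a x k =
     pochhammer c k * Digamma (c + of_nat k) * (a - x) ^ k / ((b + of_nat k) * a ^ k * fact k)"

text \<open>
  Both kinds of series converge for \<open>\<bar>x - a\<bar> < \<bar>a\<bar>\<close>.
\<close>

lemma summable_F21_term:
  assumes "b \<notin> \<int>\<^sub>\<le>\<^sub>0" "c \<notin> \<int>\<^sub>\<le>\<^sub>0" "d \<notin> \<int>\<^sub>\<le>\<^sub>0" "\<bar>z\<bar> < 1"
  shows "summable (F21_term b c d z)"
proof -
  define f where "f = (\<lambda>k. pochhammer b k * pochhammer c k / (pochhammer d k * fact k))"
  have nz: "e + real k \<noteq> 0" "pochhammer e k \<noteq> 0" if "e \<notin> \<int>\<^sub>\<le>\<^sub>0" for e k
    using that by (auto simp: pochhammer_eq_0_iff add_eq_0_iff2)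
  have lim: "(\<lambda>k. \<bar>(d + real k) * (1 + real k) / ((b + real k) * (c + real k))\<bar>) \<longlonglongrightarrow> 1"
    by real_asymp
  have "norm (f k) / norm (f (Suc k)) =
          \<bar>(d + real k) * (1 + real k) / ((b + real k) * (c + real k))\<bar>" for k
    using nz[OF assms(1), of k] nz[OF assms(2), of k] nz[OF assms(3), of k]
    by (simp add: f_def pochhammer_Suc abs_mult divide_simps)
  hence "conv_radius f = 1"
    using lim by (intro conv_radius_ratio_limit_nonzero[of _ 1]) (simp_all add: one_ereal_def)
  hence "summable (\<lambda>k. f k * z ^ k)"
    using assms(4) by (intro summable_in_conv_radius) (simp add: one_ereal_def)
  thus ?thesis
    by (simp add: f_def F21_term_def[abs_def] mult_ac)
qed

lemma summable_Psi_term: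
  assumes "b \<notin> \<int>\<^sub>\<le>\<^sub>0" "c \<notin> \<int>\<^sub>\<le>\<^sub>0" "\<bar>x - a\<bar> < \<bar>a\<bar>"
  shows "summable (Psi_term b c a x)"
proof -
  define z where "z = (a - x) / a"
  have z: "\<bar>z\<bar> < 1"
    using assms(3) by (auto simp: z_def divide_simps abs_minus_commute)
  have nz: "e + real k \<noteq> 0" "pochhammer e k \<noteq> 0" if "e \<notin> \<int>\<^sub>\<le>\<^sub>0" for e k
    using that by (auto simp: pochhammer_eq_0_iff add_eq_0_iff2)
  have "(\<lambda>k. 1 / (c + real k)) \<longlonglongrightarrow> 0"
    by real_asymp
  hence "Bseq (\<lambda>k. 1 / (c + real k))"
    by (intro convergent_imp_Bseq convergentI)
  then obtain K where K: "\<bar>1 / (c + real k)\<bar> \<le> K" for k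
    by (auto simp: Bseq_def)
  define C where "C = max \<bar>Digamma c\<bar> K"
  have bound: "\<bar>Digamma (c + real k)\<bar> \<le> C * (1 + real k)" for k
  proof (induction k)
    case (Suc k)
    have "Digamma (c + real (Suc k)) = Digamma (c + real k) + 1 / (c + real k)"
      using Digamma_plus1[of "c + real k"] nz(1)[OF assms(2), of k] by (simp add: add_ac)
    also have "\<bar>\<dots>\<bar> \<le> C * (1 + real k) + C"
      by (rule order_trans[OF abs_triangle_ineq add_mono[OF Suc.IH]])
         (use K[of k] in \<open>simp only: C_def max.coboundedI2\<close>)
    finally show ?case by (simp add: algebra_simps)
  qed (simp add: C_def)
  define g where "g = (\<lambda>k. pochhammer c k * (1 + real k) / ((b + real k) * fact k))"
  have lim: "(\<lambda>k. \<bar>(1 + real k) * (1 + real k) * (b + 1 + real k) /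
                     ((c + real k) * (b + real k) * (2 + real k))\<bar>) \<longlonglongrightarrow> 1"
    by real_asymp
  have "norm (g k) / norm (g (Suc k)) =
          \<bar>(1 + real k) * (1 + real k) * (b + 1 + real k) /
           ((c + real k) * (b + real k) * (2 + real k))\<bar>" for k
    using nz[OF assms(2), of k] nz[OF assms(1), of k] nz(1)[OF assms(1), of "Suc k"]
    by (simp add: g_def pochhammer_Suc abs_mult divide_simps add_ac)
  hence "conv_radius g = 1"
    using lim by (intro conv_radius_ratio_limit_nonzero[of _ 1]) (simp_all add: one_ereal_def)
  hence "summable (\<lambda>k. norm (g k * z ^ k))"
    using z by (intro abs_summable_in_conv_radius) (simp add: one_ereal_def)
  hence "summable (\<lambda>k. C * norm (g k * z ^ k))"
    by (rule summable_mult)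
  moreover have "norm (Psi_term b c a x k) \<le> C * norm (g k * z ^ k)" for k
  proof -
    have "norm (Psi_term b c a x k) =
            \<bar>pochhammer c k / ((b + real k) * fact k) * z ^ k\<bar> * \<bar>Digamma (c + real k)\<bar>"
      by (simp add: Psi_term_def z_def abs_mult power_divide mult_ac)
    also have "\<dots> \<le> \<bar>pochhammer c k / ((b + real k) * fact k) * z ^ k\<bar> * (C * (1 + real k))"
      by (intro mult_left_mono bound) auto
    also have "\<dots> = C * norm (g k * z ^ k)"
      by (simp add: g_def abs_mult)
    finally show ?thesis .
  qed
  ultimately show ?thesis
    by (rule summable_comparison_test'[where N = 0])
qed

end

theory Submission
  imports Defs
begin

text \<open>
  The substitution \<open>y = 1 - x / t\<close> takes the two integrals
  \<open>\<integral> (x - t)^(b - 1) t^p dt\<close> and \<open>\<integral> (x - t)^(b - 1) t^p ln t dt\<close> over \<open>[a, x]\<close> to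
  integrals of \<open>\<bar>y\<bar>^(b - 1) (1 - y)^(- c)\<close> and \<open>- \<bar>y\<bar>^(b - 1) (1 - y)^(- c) ln (1 - y)\<close>
  between \<open>z = (a - x) / a\<close> and \<open>0\<close>, where \<open>c = b + p + 1\<close>, up to constant factors and, for the
  second, \<open>ln \<bar>x\<bar>\<close> times the first. The binomial series expands
  \<open>(1 - y)^(- c)\<close>, and its derivative with respect to the exponent,
  \<open>\<Sum> (c)_k (\<Psi>(c + k) - \<Psi>(c)) y^k / k!\<close>, expands \<open>- (1 - y)^(- c) ln (1 - y)\<close>. Integrating against
  \<open>\<bar>y\<bar>^(b - 1)\<close> divides the \<open>k\<close>-th coefficient by \<open>b + k\<close>; this turns the first series into
  the hypergeometric one and the second into the digamma series minus \<open>\<Psi>(c)\<close> times the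
  hypergeometric one.

  No integral has to be exchanged with a limit. The integrated series gives an explicit primitive
  of the integrand, and \<open>has_integral_power_series_kernel\<close> applies the fundamental
  theorem of calculus to it. This needs the primitive to be continuous on the closed interval and
  differentiable inside only, so the singularity of the weight at \<open>t = x\<close> is harmless. It also
  covers \<open>x = 2 a\<close>, where \<open>z = -1\<close> and the series may converge conditionally: Abel's limit
  theorem (\<open>Abel_continuous_on\<close>) provides the continuity at \<open>t = a\<close>.

  Convergence of the hypergeometric series forces \<open>\<bar>z\<bar> \<le> 1\<close>
  (\<open>summable_F21_term_imp_abs_le_1\<close>), and then \<open>a\<close> and \<open>x\<close> have the same sign. On such an
  interval \<open>t^p\<close> and \<open>Ln t\<close> are \<open>\<bar>t\<bar>^p\<close> and \<open>ln \<bar>t\<bar>\<close> up to constants, and for a negative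
  interval the phases of \<open>x^(p + b)\<close> and \<open>a^b\<close> differ exactly by the sign of \<open>t^p\<close>
  (\<open>has_integral_kernel_powi_Ln\<close>).

  The fractional integral is the case \<open>b = \<alpha>\<close>, \<open>p = 2 n\<close>. For the Caputo derivative, Leibniz'
  rule shows that the \<open>m\<close>-th derivative of \<open>t^(2 n) Ln t\<close> has the form
  \<open>t^(2 n - m) (A Ln t + B)\<close> (\<open>nth_vector_derivative_power_Ln\<close>), so that the same integral
  formula applies with \<open>b = m - \<alpha>\<close> and the possibly negative exponent \<open>p = 2 n - m\<close>.
\<close>

section \<open>Abel's limit theorem\<close>

lemma Abel_summation:
  fixes c :: "nat \<Rightarrow> real"
  shows "(\<Sum>k<n. c k * s ^ k) =
           (\<Sum>k<n. c k) * s ^ n + (\<Sum>k<n. (\<Sum>j<Suc k. c j) * (s ^ k - s ^ Suc k))"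
  by (induction n) (simp_all add: algebra_simps)

text \<open>
  In the summation by parts the weights \<open>s^n\<close> and \<open>s^k - s^(k+1)\<close> are nonnegative with sum \<open>1\<close>,
  so the left-hand side is an average of partial sums of \<open>c\<close>.
\<close>

lemma Abel_inequality:
  fixes c :: "nat \<Rightarrow> real"
  assumes "\<And>k. \<bar>\<Sum>j<k. c j\<bar> \<le> e" and "0 \<le> s" "s \<le> 1"
  shows "\<bar>\<Sum>k<n. c k * s ^ k\<bar> \<le> e"
proof -
  have "\<bar>\<Sum>k<n. (\<Sum>j<Suc k. c j) * (s ^ k - s ^ Suc k)\<bar> \<le> (\<Sum>k<n. e * (s ^ k - s ^ Suc k))"
  proof (rule order_trans[OF sum_abs sum_mono])
    fix k
    have "0 \<le> s ^ k - s ^ Suc k"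
      using assms(2,3) by (simp add: mult_left_le_one_le)
    thus "\<bar>(\<Sum>j<Suc k. c j) * (s ^ k - s ^ Suc k)\<bar> \<le> e * (s ^ k - s ^ Suc k)"
      unfolding abs_mult using assms(1)[of "Suc k"] by (simp only: abs_of_nonneg mult_right_mono)
  qed
  also have "(\<Sum>k<n. e * (s ^ k - s ^ Suc k)) = e * (1 - s ^ n)"
    by (simp only: sum_distrib_left[symmetric] sum_lessThan_telescope') simp
  finally have "\<bar>\<Sum>k<n. (\<Sum>j<Suc k. c j) * (s ^ k - s ^ Suc k)\<bar> \<le> e * (1 - s ^ n)" .
  moreover have "\<bar>(\<Sum>k<n. c k) * s ^ n\<bar> \<le> e * s ^ n"
    using assms by (simp add: abs_mult mult_right_mono)
  ultimately show ?thesis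
    unfolding Abel_summation[of c s n] by (simp add: algebra_simps)
qed

text \<open>
  By Abel's inequality, the tails of the power series are bounded on the whole closed interval by
  the tails of the series at \<open>s = 1\<close>, so that convergence is uniform up to the endpoint, even
  if it is only conditional there.
\<close>

lemma Abel_continuous_on:
  fixes c :: "nat \<Rightarrow> real"
  assumes "summable c"
  shows "continuous_on {0..1} (\<lambda>s. \<Sum>k. c k * s ^ k)"
proof -
  have "uniformly_Cauchy_on {0..1} (\<lambda>n s. \<Sum>k<n. c k * s ^ k)"
  proof (rule uniformly_Cauchy_onI')
    fix e :: real assume "e > 0"
    then obtain M where M: "\<bar>sum c {m..<n}\<bar> < e / 2" if "m \<ge> M" for m n
      using assms unfolding summable_Cauchy by (metis half_gt_zero real_norm_def)
    have "dist (\<Sum>k<m. c k * s ^ k) (\<Sum>k<n. c k * s ^ k) < e"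
      if "s \<in> {0..1}" "m \<ge> M" "n > m" for s m n
    proof -
      have s: "0 \<le> s" "s \<le> 1" using that by auto
      have "\<bar>\<Sum>j<k. c (j + m)\<bar> \<le> e / 2" for k
        using M[of m "k + m"] that sum.shift_bounds_nat_ivl[of c 0 m k]
        by (simp add: lessThan_atLeast0)
      from Abel_inequality[OF this s]
      have *: "\<bar>\<Sum>k<n-m. c (k + m) * s ^ k\<bar> \<le> e / 2" .
      have "(\<Sum>k<n. c k * s ^ k) - (\<Sum>k<m. c k * s ^ k) = (\<Sum>k=m..<n. c k * s ^ k)"
        using that sum.atLeastLessThan_concat[of 0 m n "\<lambda>k. c k * s ^ k"]
        by (simp add: lessThan_atLeast0)
      also have "\<dots> = (\<Sum>k<n-m. c (k + m) * s ^ (k + m))"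
        using sum.shift_bounds_nat_ivl[of "\<lambda>k. c k * s ^ k" 0 m "n - m"] that
        by (simp add: lessThan_atLeast0)
      also have "\<dots> = s ^ m * (\<Sum>k<n-m. c (k + m) * s ^ k)"
        by (simp add: sum_distrib_left power_add mult_ac)
      finally have "dist (\<Sum>k<m. c k * s ^ k) (\<Sum>k<n. c k * s ^ k) =
          s ^ m * \<bar>\<Sum>k<n-m. c (k + m) * s ^ k\<bar>"
        using s by (simp add: dist_real_def abs_minus_commute[of "sum _ {..<m}"] abs_mult)
      also have "\<dots> \<le> 1 * (e / 2)"
        using s * by (intro mult_mono power_le_one) auto
      finally show ?thesis using \<open>e > 0\<close> by simp
    qed
    thus "\<exists>M. \<forall>s\<in>{0..1}. \<forall>m\<ge>M. \<forall>n>m. dist (\<Sum>k<m. c k * s ^ k) (\<Sum>k<n. c k * s ^ k) < e"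
      by blast
  qed
  hence "uniform_limit {0..1} (\<lambda>n s. \<Sum>k<n. c k * s ^ k)
           (\<lambda>s. lim (\<lambda>n. \<Sum>k<n. c k * s ^ k)) sequentially"
    using Cauchy_uniformly_convergent uniformly_convergent_uniform_limit_iff by blast
  thus ?thesis
    unfolding suminf_eq_lim
    by (rule uniform_limit_theorem[rotated])
       (simp, intro always_eventually allI continuous_intros)
qed

section \<open>Integrating a power series against the kernel\<close>

text \<open>
  Dividing the coefficients by \<open>b + k\<close> inverts the operator \<open>y d/dy + b\<close>.
\<close>

lemma power_series_radial_ODE:
  fixes q :: "nat \<Rightarrow> real" and b y z :: real
  assumes "b > 0" and sm: "summable (\<lambda>k. q k / (b + k) * z ^ k)" and y: "\<bar>y\<bar> < \<bar>z\<bar>"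
  obtains D where
    "((\<lambda>y. \<Sum>k. q k / (b + k) * y ^ k) has_real_derivative D) (at y)"
    "(\<lambda>k. q k * y ^ k) sums (y * D + b * (\<Sum>k. q k / (b + k) * y ^ k))"
proof -
  define c where "c = (\<lambda>k. q k / (b + real k))"
  have smc: "summable (\<lambda>k. c k * z ^ k)" using sm by (simp add: c_def)
  have 1: "((\<lambda>y. \<Sum>k. c k * y ^ k) has_real_derivative (\<Sum>k. diffs c k * y ^ k)) (at y)"
    by (rule termdiffs_strong[OF smc]) (use y in simp)
  have "summable (\<lambda>k. diffs c k * y ^ k)"
    by (rule termdiff_converges[of y "\<bar>z\<bar>"])
       (use y powser_inside[OF smc] in auto)
  hence "(\<lambda>k. diffs c k * y ^ k) sums (\<Sum>k. diffs c k * y ^ k)"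
    by (rule summable_sums)
  hence "(\<lambda>k. y * (diffs c k * y ^ k)) sums (y * (\<Sum>k. diffs c k * y ^ k))"
    by (rule sums_mult)
  hence "(\<lambda>k. real (Suc k) * c (Suc k) * y ^ Suc k) sums (y * (\<Sum>k. diffs c k * y ^ k))"
    by (simp add: diffs_def mult_ac)
  hence 2: "(\<lambda>k. real k * c k * y ^ k) sums (y * (\<Sum>k. diffs c k * y ^ k))"
    by (subst (asm) sums_Suc_iff) simp
  have "(\<lambda>k. c k * y ^ k) sums (\<Sum>k. c k * y ^ k)"
    by (rule summable_sums, rule powser_inside[OF smc]) (use y in simp)
  hence "(\<lambda>k. b * (c k * y ^ k)) sums (b * (\<Sum>k. c k * y ^ k))"
    by (rule sums_mult)
  from sums_add[OF 2 this]
  have "(\<lambda>k. (b + k) * c k * y ^ k) sums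
          (y * (\<Sum>k. diffs c k * y ^ k) + b * (\<Sum>k. c k * y ^ k))"
    by (simp add: algebra_simps)
  moreover have "(b + k) * c k = q k" for k
  proof -
    have "b + real k \<noteq> 0" using \<open>b > 0\<close> of_nat_0_le_iff[of k] by linarith
    thus ?thesis by (simp add: c_def)
  qed
  ultimately show ?thesis
    using that 1 unfolding c_def by simp
qed

text \<open>
  With \<open>S\<close> the series on the right, a primitive of the integrand is
  \<open>- \<bar>y\<bar>^b S(y) / \<bar>x\<bar>\<close> at \<open>y = 1 - x / t\<close>, because \<open>y S' + b S = Q\<close>. It vanishes at \<open>t = x\<close>, and
  at \<open>t = a\<close> it contributes the stated value. As \<open>t\<close> runs from \<open>a\<close> to \<open>x\<close>, the point \<open>y\<close> runs
  along the segment from \<open>z\<close> to \<open>0\<close>, so \<open>S\<close> need not converge beyond \<open>z\<close>.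
\<close>

lemma has_integral_power_series_kernel:
  fixes q :: "nat \<Rightarrow> real" and Q :: "real \<Rightarrow> real" and a b x :: real
  defines "z \<equiv> (a - x) / a"
  assumes "b > 0" and "a < x" and "a * x > 0" and z1: "\<bar>z\<bar> \<le> 1"
    and sm: "summable (\<lambda>k. q k / (b + k) * z ^ k)"
    and Q: "\<And>y. \<bar>y\<bar> < 1 \<Longrightarrow> (\<lambda>k. q k * y ^ k) sums Q y"
  shows "((\<lambda>t. (x - t) powr (b - 1) * \<bar>t\<bar> powr (- b - 1) * Q (1 - x / t)) has_integral
           \<bar>z\<bar> powr b / \<bar>x\<bar> * (\<Sum>k. q k / (b + k) * z ^ k)) {a..x}"
proof -
  define \<sigma> where "\<sigma> = sgn a"
  have sgn_ivl: "t \<noteq> 0" "\<bar>t\<bar> = \<sigma> * t" if "t \<in> {a..x}" for t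
    using assms(3,4) that by (auto simp: \<sigma>_def sgn_if zero_less_mult_iff)
  have a: "a \<noteq> 0" "\<sigma> * a = \<bar>a\<bar>" and x: "x \<noteq> 0" "\<sigma> * x = \<bar>x\<bar>"
    using sgn_ivl[of a] sgn_ivl[of x] \<open>a < x\<close> by simp_all
  have sig1: "\<sigma> * \<sigma> = 1" using a(1) by (simp add: \<sigma>_def sgn_if)
  have z0: "z \<noteq> 0" using assms(3) a by (simp add: z_def)
  define S where "S = (\<lambda>y. \<Sum>k. q k / (b + real k) * y ^ k)"
  \<comment> \<open>\<open>w t\<close> is \<open>\<bar>1 - x / t\<bar>\<close>, in a form that is differentiable without case distinction.\<close>
  define w where "w = (\<lambda>t. \<sigma> * (x / t - 1))"
  have w: "w t = (x - t) / \<bar>t\<bar>" if "t \<in> {a..x}" for t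
  proof -
    have "w t * \<bar>t\<bar> = \<sigma> * \<sigma> * (x / t * t - t)"
      using sgn_ivl[OF that] by (simp add: w_def algebra_simps)
    thus ?thesis
      using sgn_ivl[OF that] sig1 by (metis abs_eq_0 eq_divide_eq mult_1 nonzero_eq_divide_eq)
  qed
  have y_w: "1 - x / t = - \<sigma> * w t" for t
    using sig1 by (simp add: w_def algebra_simps flip: mult.assoc)
  have wa: "w a = \<bar>z\<bar>" using w[of a] \<open>a < x\<close> by (simp add: z_def)
  have w_less: "w t < \<bar>z\<bar>" if "t \<in> {a<..x}" for t
  proof -
    have "\<sigma> * x / t < \<sigma> * x / a"
      using that assms(3,4) x
      by (cases "a > 0") (auto simp: \<sigma>_def field_simps zero_less_mult_iff sgn_if)
    hence "w t < w a"
      by (simp add: w_def algebra_simps)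
    thus ?thesis by (simp add: wa)
  qed
  have w_nonneg: "w t \<ge> 0" if "t \<in> {a..x}" for t
    using w[OF that] that by simp
  have abs_y: "\<bar>1 - x / t\<bar> = w t" if "t \<in> {a..x}" for t
    unfolding y_w using w_nonneg[OF that] a(1) by (simp add: abs_mult \<sigma>_def abs_sgn_eq)
  have z_sig: "z = - \<sigma> * \<bar>z\<bar>"
    using y_w[of a] a(1) by (simp add: wa) (simp add: z_def field_simps)
  have cont_w: "continuous_on {a..x} w"
    unfolding w_def using sgn_ivl(1) by (intro continuous_intros) auto
  have cont: "continuous_on {a..x} (\<lambda>t. w t powr b * S (1 - x / t))"
  proof (intro continuous_on_mult continuous_on_powr' continuous_on_const cont_w)
    have "continuous_on {0..1} (\<lambda>s. \<Sum>k. q k / (b + k) * z ^ k * s ^ k)"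
      by (rule Abel_continuous_on[OF sm])
    moreover have "continuous_on {a..x} (\<lambda>t. w t / \<bar>z\<bar>)"
      using z0 by (intro continuous_intros cont_w) auto
    moreover have "w t / \<bar>z\<bar> \<in> {0..1}" if "t \<in> {a..x}" for t
      using w_nonneg[OF that] w_less[of t] wa z0 that by (cases "t = a") (auto simp: field_simps)
    hence "(\<lambda>t. w t / \<bar>z\<bar>) ` {a..x} \<subseteq> {0..1}" by blast
    ultimately have "continuous_on {a..x} (\<lambda>t. \<Sum>k. q k / (b + k) * z ^ k * (w t / \<bar>z\<bar>) ^ k)"
      by (rule continuous_on_compose2)
    moreover have "z * (w t / \<bar>z\<bar>) = 1 - x / t" for t
      unfolding y_w using z_sig z0 by (metis (no_types) abs_eq_0 nonzero_mult_div_cancel_left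
          mult.assoc times_divide_eq_right mult.commute)
    hence "q k / (b + k) * z ^ k * (w t / \<bar>z\<bar>) ^ k = q k / (b + k) * (1 - x / t) ^ k" for k t
      by (metis mult.assoc power_mult_distrib)
    ultimately show "continuous_on {a..x} (\<lambda>t. S (1 - x / t))"
      by (simp only: S_def)
  qed (use w_nonneg \<open>b > 0\<close> in auto)
  have deriv: "((\<lambda>t. w t powr b * S (1 - x / t)) has_real_derivative
           - \<bar>x\<bar> * ((x - t) powr (b - 1) * \<bar>t\<bar> powr (- b - 1) * Q (1 - x / t))) (at t)"
    if t: "t \<in> {a<..<x}" for t
  proof -
    have t': "t \<in> {a..x}" using t by auto
    have t0: "t \<noteq> 0" using sgn_ivl[OF t'] by auto
    define y where "y = 1 - x / t"
    have "\<bar>y\<bar> < \<bar>z\<bar>" using abs_y[OF t'] w_less[of t] t by (simp add: y_def)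
    then obtain D where D: "(S has_real_derivative D) (at y)"
      and D': "(\<lambda>k. q k * y ^ k) sums (y * D + b * S y)"
      using power_series_radial_ODE[OF \<open>b > 0\<close> sm] unfolding S_def by blast
    have "Q y = y * D + b * S y"
      using sums_unique2[OF Q D'] \<open>\<bar>y\<bar> < \<bar>z\<bar>\<close> z1 by auto
    have wpos: "w t > 0" using w[OF t'] t t0 by simp
    have dw: "(w has_real_derivative (- \<sigma> * x / t\<^sup>2)) (at t)"
      unfolding w_def using t0
      by (auto intro!: derivative_eq_intros simp: power2_eq_square)
    have dy: "((\<lambda>t. 1 - x / t) has_real_derivative (x / t\<^sup>2)) (at t)"
      using t0 by (auto intro!: derivative_eq_intros simp: power2_eq_square)
    have "((\<lambda>t. w t powr b * S (1 - x / t)) has_real_derivative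
            (b * w t powr (b - 1) * (- \<sigma> * x / t\<^sup>2)) * S y + w t powr b * (D * (x / t\<^sup>2))) (at t)"
      using DERIV_mult[OF DERIV_fun_powr[OF dw wpos, of b] DERIV_chain2[OF D[unfolded y_def] dy]]
      by (simp add: y_def mult_ac add_ac)
    also have "(b * w t powr (b - 1) * (- \<sigma> * x / t\<^sup>2)) * S y + w t powr b * (D * (x / t\<^sup>2)) =
               - \<bar>x\<bar> / t\<^sup>2 * w t powr (b - 1) * Q y"
    proof -
      have 1: "w t powr b = w t * w t powr (b - 1)"
        using wpos by (simp add: powr_diff)
      have 2: "x * w t = - \<bar>x\<bar> * y"
        using y_w[of t] x(2) sig1 unfolding y_def
        by (metis mult.commute mult.left_commute mult_1 mult_minus_left mult_minus_right minus_minus)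
      have "w t powr b * (D * (x / t\<^sup>2)) = (x * w t) * (w t powr (b - 1) * D / t\<^sup>2)"
        by (simp add: 1)
      also have "\<dots> = - \<bar>x\<bar> / t\<^sup>2 * w t powr (b - 1) * (y * D)"
        by (simp add: 2)
      finally show ?thesis
        by (simp add: \<open>Q y = _\<close> x(2) ring_distribs)
    qed
    also have "\<dots> = - \<bar>x\<bar> * ((x - t) powr (b - 1) * \<bar>t\<bar> powr (- b - 1) * Q y)"
    proof -
      have "\<bar>t\<bar> powr (- b - 1) = \<bar>t\<bar> powr (- (b - 1) - 2)"
        by (rule arg_cong[where f = "\<lambda>r. \<bar>t\<bar> powr r"]) simp
      also have "\<dots> = 1 / (\<bar>t\<bar> powr (b - 1) * t\<^sup>2)"
        using t0 unfolding powr_diff powr_minus by simp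
      finally have "w t powr (b - 1) / t\<^sup>2 = (x - t) powr (b - 1) * \<bar>t\<bar> powr (- b - 1)"
        using w[OF t'] t by (simp add: powr_divide)
      thus ?thesis
        by (metis (no_types, opaque_lifting) mult.assoc mult.commute times_divide_eq_left)
    qed
    finally show ?thesis unfolding y_def .
  qed
  have "((\<lambda>t. - \<bar>x\<bar> * ((x - t) powr (b - 1) * \<bar>t\<bar> powr (- b - 1) * Q (1 - x / t))) has_integral
          (w x powr b * S (1 - x / x) - w a powr b * S (1 - x / a))) {a..x}"
    using \<open>a < x\<close> deriv
    by (intro fundamental_theorem_of_calculus_interior cont)
       (auto simp: has_real_derivative_iff_has_vector_derivative)
  from has_integral_mult_right[OF this, of "- 1 / \<bar>x\<bar>"]
  have "((\<lambda>t. (x - t) powr (b - 1) * \<bar>t\<bar> powr (- b - 1) * Q (1 - x / t)) has_integral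
          - 1 / \<bar>x\<bar> * (w x powr b * S (1 - x / x) - w a powr b * S (1 - x / a))) {a..x}"
    by (rule has_integral_eq[rotated]) (use x(1) in simp)
  moreover have "w x = 0" "1 - x / a = z"
    using w[of x] \<open>a < x\<close> a(1) by (simp_all add: z_def diff_divide_distrib)
  ultimately show ?thesis
    by (simp add: wa S_def)
qed

section \<open>The binomial series and its derivative in the exponent\<close>

lemma sums_binomial_series_pochhammer:
  fixes c y :: real
  assumes "\<bar>y\<bar> < 1"
  shows "(\<lambda>k. pochhammer c k / fact k * y ^ k) sums ((1 - y) powr (- c))"
proof -
  have "(- 1) ^ k * (- y) ^ k = y ^ k" for k :: nat
    by (simp flip: power_mult_distrib)
  hence "((- c) gchoose k) * (- y) ^ k = pochhammer c k / fact k * y ^ k" for k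
    by (simp add: gbinomial_pochhammer mult.assoc mult.left_commute)
  thus ?thesis
    using gen_binomial_real[of "- y" "- c"] assms by simp
qed

text \<open>
  Formally this is \<open>d/dc\<close> of the binomial series, since \<open>(c)_k\<close> has logarithmic derivative
  \<open>\<Psi>(c + k) - \<Psi>(c)\<close>. The proof avoids differentiating in the parameter: the functional equation
  \<open>\<Psi>(s + 1) = \<Psi>(s) + 1 / s\<close> gives a recurrence for the coefficients that says
  \<open>(1 - y) Q' = c Q + (1 - y)^(- c)\<close> for the sum \<open>Q\<close>, and this equation has the stated solution.
\<close>

lemma sums_digamma_binomial_series:
  fixes c y :: real
  assumes c: "c \<notin> \<int>\<^sub>\<le>\<^sub>0" and y: "\<bar>y\<bar> < 1"
  shows "(\<lambda>k. pochhammer c k * Digamma (c + k) / fact k * y ^ k) sums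
           ((Digamma c - ln (1 - y)) * (1 - y) powr (- c))"
proof -
  define q where "q = (\<lambda>k. pochhammer c k * Digamma (c + real k) / fact k)"
  define T where "T = (\<lambda>y::real. (1 - y) powr (- c))"
  \<comment> \<open>The series with coefficients \<open>q k / (1 + k)\<close> is a digamma series of the kind known to converge;
     differentiating it termwise gives convergence for \<open>q k\<close> itself.\<close>
  have sm1: "summable (\<lambda>k. q k / (1 + real k) * y ^ k)" if "\<bar>y\<bar> < 1" for y
  proof -
    have "Psi_term 1 c 1 (1 - y) = (\<lambda>k. q k / (1 + real k) * y ^ k)"
      by (intro ext) (simp add: Psi_term_def q_def mult_ac)
    moreover have "summable (Psi_term 1 c 1 (1 - y))"
      by (rule summable_Psi_term) (use c that in \<open>auto elim!: nonpos_Ints_cases\<close>)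
    ultimately show ?thesis by (simp only:)
  qed
  have sm: "summable (\<lambda>k. q k * y ^ k)" if y: "\<bar>y\<bar> < 1" for y
  proof -
    have "summable (\<lambda>k. q k / (1 + real k) * ((\<bar>y\<bar> + 1) / 2) ^ k)"
      by (rule sm1) (use y in \<open>auto simp: abs_if\<close>)
    thus ?thesis
      by (rule power_series_radial_ODE[of 1, rotated, where y = y])
         (use y in \<open>auto simp: sums_iff\<close>)
  qed
  define Q where "Q = (\<lambda>y. \<Sum>k. q k * y ^ k)"
  have "((\<lambda>y. Q y * (1 - y) powr c + ln (1 - y)) has_real_derivative 0) (at y)"
    if y: "\<bar>y\<bar> < 1" for y
  proof -
    define D where "D = (\<Sum>k. diffs q k * y ^ k)"
    have QD: "(Q has_real_derivative D) (at y)"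
      unfolding Q_def D_def by (rule termdiffs_strong'[of 1]) (use sm y in auto)
    have 1: "(\<lambda>k. diffs q k * y ^ k) sums D"
      unfolding D_def by (intro summable_sums termdiff_converges[of y 1]) (use sm y in auto)
    have 2: "(\<lambda>k. real k * q k * y ^ k) sums (y * D)"
    proof -
      have "(\<lambda>k. real (Suc k) * q (Suc k) * y ^ Suc k) sums (y * D)"
        using sums_mult[OF 1, of y] by (simp add: diffs_def mult_ac)
      thus ?thesis by (subst (asm) sums_Suc_iff) simp
    qed
    have 3: "(\<lambda>k. q k * y ^ k) sums Q y"
      unfolding Q_def by (rule summable_sums[OF sm[OF y]])
    have 4: "(\<lambda>k. pochhammer c k / fact k * y ^ k) sums T y"
      unfolding T_def by (rule sums_binomial_series_pochhammer[OF y])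
    have coeff: "diffs q k = real k * q k + c * q k + pochhammer c k / fact k" for k
    proof -
      have nz: "c + real k \<noteq> 0"
        using c by (auto simp: add_eq_0_iff2)
      have "Digamma (c + real (Suc k)) = Digamma (c + real k) + 1 / (c + real k)"
        using Digamma_plus1[OF nz] by (simp add: add_ac)
      moreover have "diffs q k = pochhammer c k * ((c + real k) * Digamma (c + real (Suc k))) / fact k"
        by (simp add: diffs_def q_def pochhammer_Suc del: of_nat_Suc)
      ultimately have "diffs q k =
          pochhammer c k * ((c + real k) * Digamma (c + real k) + 1) / fact k"
        using nz by (simp add: distrib_left)
      thus ?thesis
        by (simp add: q_def algebra_simps add_divide_distrib)
    qed
    have "(\<lambda>k. diffs q k * y ^ k) sums (y * D + c * Q y + T y)"
      using sums_add[OF sums_add[OF 2 sums_mult[OF 3, of c]] 4]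
      by (simp add: coeff algebra_simps)
    with 1 have D: "D = y * D + c * Q y + T y"
      by (rule sums_unique2)
    have "((\<lambda>y. Q y * (1 - y) powr c + ln (1 - y)) has_real_derivative
             D * (1 - y) powr c - Q y * (c * (1 - y) powr (c - 1)) - 1 / (1 - y)) (at y)"
      using y by (auto intro!: derivative_eq_intros QD)
    also have "D * (1 - y) powr c - Q y * (c * (1 - y) powr (c - 1)) - 1 / (1 - y) =
               ((1 - y) * D - c * Q y - T y) * (1 - y) powr (c - 1)"
    proof -
      have 1: "(1 - y) powr c = (1 - y) * (1 - y) powr (c - 1)"
        and 2: "T y * (1 - y) powr (c - 1) = 1 / (1 - y)"
        using y by (simp_all add: T_def powr_diff powr_minus)
      show ?thesis unfolding 1 2[symmetric] by (simp add: algebra_simps)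
    qed
    also have "\<dots> = 0" using D by (simp add: algebra_simps)
    finally show ?thesis .
  qed
  hence "\<exists>C. \<forall>y\<in>{-1<..<1}. Q y * (1 - y) powr c + ln (1 - y) = C"
    by (intro has_field_derivative_zero_constant)
       (auto intro: has_field_derivative_at_within simp: abs_if)
  then obtain C where C: "Q y * (1 - y) powr c + ln (1 - y) = C" if "\<bar>y\<bar> < 1" for y
    by (force simp: abs_if)
  have "Q 0 = Digamma c" unfolding Q_def powser_zero by (simp add: q_def)
  hence "C = Digamma c" using C[of 0] by simp
  hence "Q y * (1 - y) powr c = Digamma c - ln (1 - y)"
    using C[OF y] by simp
  hence "Q y = (Digamma c - ln (1 - y)) * (1 - y) powr (- c)"
    using y by (simp add: powr_minus field_simps)
  moreover have "(\<lambda>k. q k * y ^ k) sums Q y"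
    unfolding Q_def by (rule summable_sums[OF sm[OF y]])
  ultimately show ?thesis by (simp add: q_def)
qed

section \<open>Hypergeometric series with lower parameter \<open>b + 1\<close>\<close>

lemma pochhammer_quotient_plus_one:
  fixes b :: real
  assumes "b \<notin> \<int>\<^sub>\<le>\<^sub>0"
  shows "pochhammer b k / pochhammer (b + 1) k = b / (b + k)"
proof -
  have "pochhammer b k * (b + k) = b * pochhammer (b + 1) k"
    using pochhammer_Suc[of b k] pochhammer_rec[of b k] by simp
  moreover have "b + real k \<noteq> 0" using assms by (auto simp: add_eq_0_iff2)
  moreover have "pochhammer (b + 1) k \<noteq> 0"
    using assms plus_one_in_nonpos_Ints_imp[of b] by (auto simp: pochhammer_eq_0_iff)
  ultimately show ?thesis by (simp add: field_simps)
qed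

lemma F21_term_shifted:
  assumes "b \<notin> \<int>\<^sub>\<le>\<^sub>0"
  shows "F21_term b c (b + 1) z k = b * (pochhammer c k / fact k / (b + k) * z ^ k)"
proof -
  have "F21_term b c (b + 1) z k =
          pochhammer b k / pochhammer (b + 1) k * (pochhammer c k / fact k * z ^ k)"
    by (simp add: F21_term_def)
  thus ?thesis
    unfolding pochhammer_quotient_plus_one[OF assms] by simp
qed

text \<open>
  As no parameter is a non-positive integer, the series does not terminate, and the
  ratio of consecutive coefficients shows that its radius of convergence is exactly \<open>1\<close>.
\<close>

lemma summable_F21_term_imp_abs_le_1:
  assumes "b \<notin> \<int>\<^sub>\<le>\<^sub>0" "c \<notin> \<int>\<^sub>\<le>\<^sub>0" "d \<notin> \<int>\<^sub>\<le>\<^sub>0" and "summable (F21_term b c d z)"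
  shows "\<bar>z\<bar> \<le> 1"
proof -
  define f where "f = (\<lambda>k. pochhammer b k * pochhammer c k / (pochhammer d k * fact k))"
  have nz: "e + real k \<noteq> 0" "pochhammer e k \<noteq> 0" if "e \<notin> \<int>\<^sub>\<le>\<^sub>0" for e k
    using that by (auto simp: pochhammer_eq_0_iff add_eq_0_iff2)
  have lim: "(\<lambda>k. \<bar>(d + real k) * (1 + real k) / ((b + real k) * (c + real k))\<bar>) \<longlonglongrightarrow> 1"
    by real_asymp
  have "norm (f k) / norm (f (Suc k)) =
          \<bar>(d + real k) * (1 + real k) / ((b + real k) * (c + real k))\<bar>" for k
    using nz[OF assms(1), of k] nz[OF assms(2), of k] nz[OF assms(3), of k]
    by (simp add: f_def pochhammer_Suc abs_mult divide_simps)
  hence "conv_radius f = 1"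
    using lim by (intro conv_radius_ratio_limit_nonzero[of _ 1]) (simp_all add: one_ereal_def)
  moreover have "summable (\<lambda>k. f k * z ^ k)"
    using assms(4) by (simp add: f_def F21_term_def[abs_def] mult_ac)
  ultimately show ?thesis
    using conv_radius_geI[of f z] by (simp add: one_ereal_def)
qed

section \<open>The kernel integrals of powers and of powers times logarithms\<close>

text \<open>
  On an interval of constant sign, \<open>\<bar>t\<bar>^p\<close> is the kernel \<open>\<bar>t\<bar>^(- b - 1)\<close> of
  \<open>has_integral_power_series_kernel\<close> times \<open>Q(y) = (1 - y)^(- c)\<close> at \<open>y = 1 - x / t\<close>, up to
  a factor independent of \<open>t\<close>.
\<close>

lemma rescale_kernel_power:
  fixes t x b c p :: real
  assumes "x / t > 0" and c: "c = b + p + 1"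
  shows "\<bar>x\<bar> powr c * \<bar>t\<bar> powr (- b - 1) * (x / t) powr (- c) = \<bar>t\<bar> powr p"
proof -
  have xt: "x / t = \<bar>x\<bar> / \<bar>t\<bar>" and "x \<noteq> 0" "t \<noteq> 0"
    using assms(1) by (metis abs_divide abs_of_pos, auto)
  hence "\<bar>x\<bar> powr c * \<bar>t\<bar> powr (- b - 1) * (x / t) powr (- c) = \<bar>t\<bar> powr (- b - 1) * \<bar>t\<bar> powr c"
    unfolding xt by (simp add: powr_divide powr_minus)
  also have "\<dots> = \<bar>t\<bar> powr p"
    unfolding powr_add[symmetric] by (simp add: c)
  finally show ?thesis .
qed

lemma has_integral_kernel_power:
  fixes a b c x p :: real
  defines "z \<equiv> (a - x) / a"
  assumes "b > 0" and "a < x" and "a * x > 0" and "\<bar>z\<bar> \<le> 1"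
    and sm: "summable (F21_term b c (b + 1) z)" and c: "c = b + p + 1"
  shows "((\<lambda>t. (x - t) powr (b - 1) * \<bar>t\<bar> powr p) has_integral
           \<bar>z\<bar> powr b * \<bar>x\<bar> powr (b + p) / b * F21 b c (b + 1) z) {a..x}"
proof -
  have b: "b \<notin> \<int>\<^sub>\<le>\<^sub>0" using \<open>b > 0\<close> by (auto elim!: nonpos_Ints_cases)
  let ?q = "\<lambda>k. pochhammer c k / fact k"
  have F: "F21_term b c (b + 1) z = (\<lambda>k. b * (?q k / (b + k) * z ^ k))"
    using F21_term_shifted[OF b] by (intro ext)
  have sm': "summable (\<lambda>k. ?q k / (b + k) * z ^ k)"
    using sm \<open>b > 0\<close> unfolding F by (subst (asm) summable_cmult_iff) auto
  have "F21 b c (b + 1) z = b * (\<Sum>k. ?q k / (b + k) * z ^ k)"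
    unfolding F21_def F by (rule suminf_mult[OF sm'])
  hence S: "(\<Sum>k. ?q k / (b + k) * z ^ k) = F21 b c (b + 1) z / b"
    using \<open>b > 0\<close> by simp
  have "((\<lambda>t. (x - t) powr (b - 1) * \<bar>t\<bar> powr (- b - 1) * (1 - (1 - x / t)) powr (- c)) has_integral
           \<bar>z\<bar> powr b / \<bar>x\<bar> * (\<Sum>k. ?q k / (b + k) * z ^ k)) {a..x}"
    unfolding z_def
    by (rule has_integral_power_series_kernel[where Q = "\<lambda>y. (1 - y) powr (- c)"])
       (fact assms(2-5)[unfolded z_def] sm'[unfolded z_def] sums_binomial_series_pochhammer)+
  from has_integral_mult_right[OF this, of "\<bar>x\<bar> powr c"]
  have "((\<lambda>t. \<bar>x\<bar> powr c * ((x - t) powr (b - 1) * \<bar>t\<bar> powr (- b - 1) * (x / t) powr (- c))) has_integral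
           \<bar>x\<bar> powr c * (\<bar>z\<bar> powr b / \<bar>x\<bar> * (F21 b c (b + 1) z / b))) {a..x}"
    by (simp only: S diff_diff_eq2 add_diff_cancel_left')
  moreover have "\<bar>x\<bar> powr c * ((x - t) powr (b - 1) * \<bar>t\<bar> powr (- b - 1) * (x / t) powr (- c)) =
                   (x - t) powr (b - 1) * \<bar>t\<bar> powr p" if t: "t \<in> {a..x}" for t
  proof -
    have "x / t > 0" using t assms(3,4) by (auto simp: zero_less_mult_iff zero_less_divide_iff)
    from rescale_kernel_power[OF this c] show ?thesis by (simp add: mult_ac)
  qed
  ultimately have "((\<lambda>t. (x - t) powr (b - 1) * \<bar>t\<bar> powr p) has_integral
      \<bar>x\<bar> powr c * (\<bar>z\<bar> powr b / \<bar>x\<bar> * (F21 b c (b + 1) z / b))) {a..x}"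
    by (rule has_integral_eq[rotated])
  moreover have "\<bar>x\<bar> powr c = \<bar>x\<bar> * \<bar>x\<bar> powr (b + p)"
    using \<open>a * x > 0\<close> by (simp add: c powr_add)
  hence "\<bar>x\<bar> powr c * (\<bar>z\<bar> powr b / \<bar>x\<bar> * (F21 b c (b + 1) z / b)) =
         \<bar>z\<bar> powr b * \<bar>x\<bar> powr (b + p) / b * F21 b c (b + 1) z"
    using \<open>a * x > 0\<close> by auto
  ultimately show ?thesis by (simp only:)
qed

text \<open>
  As \<open>1 - y = x / t\<close>, one has \<open>ln \<bar>t\<bar> = (\<Psi>(c) - ln (1 - y)) + (ln \<bar>x\<bar> - \<Psi>(c))\<close>. The first
  summand is the one that occurs in the digamma series, and the second is independent of \<open>t\<close>.
\<close>

lemma has_integral_kernel_power_ln: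
  fixes a b c x p :: real
  defines "z \<equiv> (a - x) / a"
  assumes "b > 0" and "a < x" and "a * x > 0" and "\<bar>z\<bar> \<le> 1" and c0: "c \<notin> \<int>\<^sub>\<le>\<^sub>0"
    and smF: "summable (F21_term b c (b + 1) z)"
    and sm: "summable (Psi_term b c a x)" and c: "c = b + p + 1"
  shows "((\<lambda>t. (x - t) powr (b - 1) * \<bar>t\<bar> powr p * ln \<bar>t\<bar>) has_integral
           \<bar>z\<bar> powr b * \<bar>x\<bar> powr (b + p) / b *
             (F21 b c (b + 1) z * (ln \<bar>x\<bar> - Digamma c) + b * (\<Sum>k. Psi_term b c a x k))) {a..x}"
proof -
  let ?q = "\<lambda>k. pochhammer c k * Digamma (c + k) / fact k"
  have P: "Psi_term b c a x = (\<lambda>k. ?q k / (b + k) * z ^ k)"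
    by (intro ext) (simp add: Psi_term_def z_def power_divide)
  have "((\<lambda>t. (x - t) powr (b - 1) * \<bar>t\<bar> powr (- b - 1) *
             ((Digamma c - ln (1 - (1 - x / t))) * (1 - (1 - x / t)) powr (- c))) has_integral
           \<bar>z\<bar> powr b / \<bar>x\<bar> * (\<Sum>k. ?q k / (b + k) * z ^ k)) {a..x}"
    unfolding z_def
    by (rule has_integral_power_series_kernel
          [where Q = "\<lambda>y. (Digamma c - ln (1 - y)) * (1 - y) powr (- c)"])
       (fact assms(2-5)[unfolded z_def] sm[unfolded P z_def] sums_digamma_binomial_series[OF c0])+
  from has_integral_add[OF has_integral_mult_right[OF this, of "\<bar>x\<bar> powr c"]
      has_integral_mult_right[OF has_integral_kernel_power[OF assms(2-5)[unfolded z_def] smF[unfolded z_def] c],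
        of "ln \<bar>x\<bar> - Digamma c"]]
  have "((\<lambda>t. \<bar>x\<bar> powr c * ((x - t) powr (b - 1) * \<bar>t\<bar> powr (- b - 1) *
             ((Digamma c - ln (x / t)) * (x / t) powr (- c))) +
            (ln \<bar>x\<bar> - Digamma c) * ((x - t) powr (b - 1) * \<bar>t\<bar> powr p)) has_integral
         (\<bar>x\<bar> powr c * (\<bar>z\<bar> powr b / \<bar>x\<bar> * (\<Sum>k. Psi_term b c a x k)) +
          (ln \<bar>x\<bar> - Digamma c) * (\<bar>z\<bar> powr b * \<bar>x\<bar> powr (b + p) / b * F21 b c (b + 1) z))) {a..x}"
    by (simp only: P z_def diff_diff_eq2 add_diff_cancel_left')
  moreover have "\<bar>x\<bar> powr c * ((x - t) powr (b - 1) * \<bar>t\<bar> powr (- b - 1) *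
             ((Digamma c - ln (x / t)) * (x / t) powr (- c))) +
            (ln \<bar>x\<bar> - Digamma c) * ((x - t) powr (b - 1) * \<bar>t\<bar> powr p) =
          (x - t) powr (b - 1) * \<bar>t\<bar> powr p * ln \<bar>t\<bar>" if t: "t \<in> {a..x}" for t
  proof -
    have "x / t > 0" using t assms(3,4) by (auto simp: zero_less_mult_iff zero_less_divide_iff)
    hence xt: "x / t = \<bar>x\<bar> / \<bar>t\<bar>" and t0: "t \<noteq> 0" by (metis abs_divide abs_of_pos, auto)
    have 1: "\<bar>x\<bar> powr c * \<bar>t\<bar> powr (- b - 1) * (x / t) powr (- c) = \<bar>t\<bar> powr p"
      using rescale_kernel_power[OF \<open>x / t > 0\<close> c] .
    have 2: "ln (x / t) = ln \<bar>x\<bar> - ln \<bar>t\<bar>"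
      unfolding xt using t0 \<open>a * x > 0\<close> by (subst ln_divide_pos) auto
    have "\<bar>x\<bar> powr c * ((x - t) powr (b - 1) * \<bar>t\<bar> powr (- b - 1) *
             ((Digamma c - ln (x / t)) * (x / t) powr (- c))) =
          (x - t) powr (b - 1) * (Digamma c - ln (x / t)) *
            (\<bar>x\<bar> powr c * \<bar>t\<bar> powr (- b - 1) * (x / t) powr (- c))"
      by (simp add: mult_ac)
    from this[unfolded 1] show ?thesis
      by (simp only: 2) (simp add: algebra_simps)
  qed
  ultimately have "((\<lambda>t. (x - t) powr (b - 1) * \<bar>t\<bar> powr p * ln \<bar>t\<bar>) has_integral
         (\<bar>x\<bar> powr c * (\<bar>z\<bar> powr b / \<bar>x\<bar> * (\<Sum>k. Psi_term b c a x k)) +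
          (ln \<bar>x\<bar> - Digamma c) * (\<bar>z\<bar> powr b * \<bar>x\<bar> powr (b + p) / b * F21 b c (b + 1) z))) {a..x}"
    by (rule has_integral_eq[rotated])
  moreover have "\<bar>x\<bar> powr c = \<bar>x\<bar> * \<bar>x\<bar> powr (b + p)"
    using \<open>a * x > 0\<close> by (simp add: c powr_add)
  hence "\<bar>x\<bar> powr c * (\<bar>z\<bar> powr b / \<bar>x\<bar> * (\<Sum>k. Psi_term b c a x k)) +
          (ln \<bar>x\<bar> - Digamma c) * (\<bar>z\<bar> powr b * \<bar>x\<bar> powr (b + p) / b * F21 b c (b + 1) z) =
        \<bar>z\<bar> powr b * \<bar>x\<bar> powr (b + p) / b *
             (F21 b c (b + 1) z * (ln \<bar>x\<bar> - Digamma c) + b * (\<Sum>k. Psi_term b c a x k))"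
  proof -
    have "X * P * (E / X * S) + l * (E * P / b * F) = E * P / b * (F * l + b * S)"
      if "X \<noteq> 0" for X P E S l F
      using that \<open>b > 0\<close> by (simp add: field_simps)
    thus ?thesis
      using \<open>a * x > 0\<close> \<open>\<bar>x\<bar> powr c = _\<close> by auto
  qed
  ultimately show ?thesis by (simp only:)
qed

text \<open>
  Both \<open>t^p\<close> and \<open>a^b\<close>, \<open>x^(p + b)\<close> acquire phases when \<open>a < x < 0\<close>. The integrand
  carries the sign \<open>(-1)^p\<close>, and on the right the quotient of the phases \<open>exp (\<i> \<pi> (p + b))\<close> and
  \<open>exp (\<i> \<pi> b)\<close> is the same sign because \<open>p\<close> is an integer. The imaginary part \<open>\<pi>\<close> of
  \<open>Ln t\<close> is constant and is absorbed into \<open>Ln x\<close>.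
\<close>

lemma has_integral_kernel_powi_Ln:
  fixes a b c x :: real and p :: int and u v :: complex
  defines "z \<equiv> (a - x) / a"
  assumes b: "b > 0" and "a < x" and ax: "a * x > 0" and "\<bar>z\<bar> \<le> 1" and c0: "c \<notin> \<int>\<^sub>\<le>\<^sub>0"
    and smF: "summable (F21_term b c (b + 1) z)"
    and sm: "summable (Psi_term b c a x)" and c: "c = b + p + 1"
  shows "((\<lambda>t. of_real ((x - t) powr (b - 1)) * (of_real t powi p * (u * Ln (of_real t) + v))) has_integral
           of_real x powr of_real (p + b) * of_real ((x - a) powr b) / (of_real a powr of_real b * of_real b) *
             (of_real (F21 b c (b + 1) z) * (u * (Ln (of_real x) - of_real (Digamma c)) + v) +
              u * of_real (b * (\<Sum>k. Psi_term b c a x k)))) {a..x}"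
proof -
  define e where "e = sgn a powi p"
  define L where "L = (if a < 0 then \<i> * of_real pi else 0)"
  define W where "W = \<bar>z\<bar> powr b * \<bar>x\<bar> powr (b + p) / b"
  have sgn_t: "t \<noteq> 0" "sgn t = sgn a" "t < 0 \<longleftrightarrow> a < 0" if "t \<in> {a..x}" for t
    using that ax by (auto simp: zero_less_mult_iff sgn_if)
  have powi: "of_real t powi p = (of_real (e * \<bar>t\<bar> powr p) :: complex)" if "t \<in> {a..x}" for t
  proof -
    have "t powi p = (sgn t * \<bar>t\<bar>) powi p" by (simp add: sgn_mult_abs)
    also have "\<dots> = e * \<bar>t\<bar> powr p"
      using sgn_t[OF that] by (simp add: e_def power_int_mult_distrib powr_real_of_int')
    finally show ?thesis by (metis of_real_power_int)
  qed
  have Ln: "Ln (of_real t) = of_real (ln \<bar>t\<bar>) + L" if "t \<in> {a..x}" for t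
    using sgn_t[OF that] by (simp add: Ln_of_real' L_def mult.commute)
  note hyps = b \<open>a < x\<close> ax \<open>\<bar>z\<bar> \<le> 1\<close>[unfolded z_def]
  have I0: "((\<lambda>t. of_real ((x - t) powr (b - 1) * \<bar>t\<bar> powr p)) has_integral
              (of_real (W * F21 b c (b + 1) z) :: complex)) {a..x}"
    using has_integral_linear[OF has_integral_kernel_power[OF hyps smF[unfolded z_def] c]
        bounded_linear_of_real]
    unfolding o_def W_def z_def .
  have I1: "((\<lambda>t. of_real ((x - t) powr (b - 1) * \<bar>t\<bar> powr p * ln \<bar>t\<bar>)) has_integral
              (of_real (W * (F21 b c (b + 1) z * (ln \<bar>x\<bar> - Digamma c) + b * (\<Sum>k. Psi_term b c a x k))) :: complex)) {a..x}"
    using has_integral_linear[OF has_integral_kernel_power_ln[OF hyps c0 smF[unfolded z_def] sm c]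
        bounded_linear_of_real]
    unfolding o_def W_def z_def .
  from has_integral_add[OF has_integral_mult_right[OF I1, of "of_real e * u"]
      has_integral_mult_right[OF I0, of "of_real e * (u * L + v)"]]
  have "((\<lambda>t. of_real ((x - t) powr (b - 1)) * (of_real t powi p * (u * Ln (of_real t) + v))) has_integral
     of_real e * u * of_real (W * (F21 b c (b + 1) z * (ln \<bar>x\<bar> - Digamma c) + b * (\<Sum>k. Psi_term b c a x k))) +
     of_real e * (u * L + v) * of_real (W * F21 b c (b + 1) z)) {a..x}"
    by (rule has_integral_eq[rotated]) (simp add: powi Ln algebra_simps)
  also have "of_real e * u * of_real (W * (F21 b c (b + 1) z * (ln \<bar>x\<bar> - Digamma c) + b * (\<Sum>k. Psi_term b c a x k))) +
     of_real e * (u * L + v) * of_real (W * F21 b c (b + 1) z) =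
     of_real (e * W) * (of_real (F21 b c (b + 1) z) * (u * (Ln (of_real x) - of_real (Digamma c)) + v) +
              u * of_real (b * (\<Sum>k. Psi_term b c a x k)))"
    using Ln[of x] \<open>a < x\<close> by (simp add: algebra_simps)
  also have "(of_real (e * W) :: complex) =
      of_real x powr of_real (p + b) * of_real ((x - a) powr b) / (of_real a powr of_real b * of_real b)"
  proof -
    have zW: "W = (x - a) powr b * \<bar>x\<bar> powr (p + b) / (\<bar>a\<bar> powr b * b)"
      using \<open>a < x\<close> by (simp add: W_def z_def powr_divide add.commute)
    show ?thesis
    proof (cases "a > 0")
      case True
      thus ?thesis
        using ax powr_of_real[of x "p + b"]
        by (simp add: zW e_def powr_of_real zero_less_mult_iff)
    next
      case False
      hence neg: "a < 0" "x < 0" using ax by (auto simp: zero_less_mult_iff)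
      have "exp (\<i> * of_real pi * of_real (p + b)) = exp (\<i> * of_real pi * of_real b) * exp (of_int p * (\<i> * of_real pi))"
        by (simp add: exp_add[symmetric] algebra_simps)
      also have "exp (of_int p * (\<i> * of_real pi)) = exp (\<i> * of_real pi) powi p"
        by (simp only: exp_power_int)
      also have "exp (\<i> * of_real pi) powi p = of_real e"
        using neg by (simp add: e_def)
      finally have "of_real x powr of_real (p + b) =
          of_real (\<bar>x\<bar> powr (p + b)) * (exp (\<i> * of_real pi * of_real b) * of_real e)"
        using powr_of_neg_real[OF neg(2), of "p + b"] by (simp only:)
      thus ?thesis
        unfolding zW powr_of_neg_real[OF neg(1)] by simp
    qed
  qed
  finally show ?thesis .
qed

section \<open>Iterated derivatives of \<open>t^N Ln t\<close>\<close>

text \<open>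
  Leibniz' rule for the \<open>j\<close>-th derivative of \<open>t^N Ln t\<close>: the term with \<open>r\<close> derivatives on the
  logarithm has the factor \<open>(j choose r) (-1)^(r - 1) (r - 1)!\<close>, and \<open>g i\<close> stands for the
  coefficient of the \<open>i\<close>-th derivative of \<open>t^N / N!\<close>.
\<close>

definition leibniz_log_coeff :: "(nat \<Rightarrow> real) \<Rightarrow> nat \<Rightarrow> real" where
  "leibniz_log_coeff g j = (\<Sum>r = 1..j. fact j * ((-1) ^ (r - 1) / (r * fact (j - r))) * g (j - r))"

lemma leibniz_log_coeff_binomial:
  "leibniz_log_coeff g j = (\<Sum>s<j. real (j choose Suc s) * fact s * (-1) ^ s * g (j - Suc s))"
proof -
  have "leibniz_log_coeff g j =
          (\<Sum>s<j. fact j * ((-1) ^ s / (real (Suc s) * fact (j - Suc s))) * g (j - Suc s))"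
    unfolding leibniz_log_coeff_def One_nat_def sum.atLeast1_atMost_eq by simp
  also have "\<dots> = (\<Sum>s<j. real (j choose Suc s) * fact s * (-1) ^ s * g (j - Suc s))"
    by (rule sum.cong) (simp_all add: binomial_fact Suc_leI del: of_nat_Suc)
  finally show ?thesis .
qed

text \<open>
  This is what differentiating \<open>t^(N - j) (g j Ln t + B)\<close> with \<open>B = leibniz_log_coeff g j\<close> does
  to \<open>B\<close>; the assumption is the corresponding rule for the coefficient of \<open>Ln t\<close>.
\<close>

lemma leibniz_log_coeff_Suc:
  assumes g: "\<And>i. g (Suc i) = (N - real i) * g i"
  shows "leibniz_log_coeff g (Suc j) = (N - real j) * leibniz_log_coeff g j + g j"
proof -
  \<comment> \<open>Pascal's rule splits the sum in two. Shifting one and applying the recurrence of \<open>g\<close> in the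
     other produces the sum of \<open>h\<close> with opposite signs.\<close>
  define h where "h = (\<lambda>s. real (j choose Suc s) * fact (Suc s) * (-1) ^ s * g (j - Suc s))"
  have "leibniz_log_coeff g (Suc j) =
          (\<Sum>s<Suc j. real (j choose s) * fact s * (-1) ^ s * g (j - s)) +
          (\<Sum>s<Suc j. real (j choose Suc s) * fact s * (-1) ^ s * g (j - s))"
    unfolding leibniz_log_coeff_binomial sum.distrib[symmetric]
    by (rule sum.cong) (simp_all add: algebra_simps)
  also have "(\<Sum>s<Suc j. real (j choose s) * fact s * (-1) ^ s * g (j - s)) = g j - (\<Sum>s<j. h s)"
    unfolding sum.lessThan_Suc_shift h_def by (simp add: sum_negf)
  also have "(\<Sum>s<Suc j. real (j choose Suc s) * fact s * (-1) ^ s * g (j - s)) =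
             (\<Sum>s<j. real (j choose Suc s) * fact s * (-1) ^ s * g (j - s))"
    by simp
  also have "\<dots> = (\<Sum>s<j. (N - real j) * (real (j choose Suc s) * fact s * (-1) ^ s * g (j - Suc s)) + h s)"
  proof (rule sum.cong)
    fix s assume "s \<in> {..<j}"
    hence s: "s < j" by simp
    have "g (j - s) = (N - real (j - Suc s)) * g (j - Suc s)"
      using g[of "j - Suc s"] s by (simp add: Suc_diff_Suc)
    also have "N - real (j - Suc s) = (N - real j) + real (Suc s)"
      using s by (simp add: of_nat_diff)
    finally have gs: "g (j - s) = (N - real j + real (Suc s)) * g (j - Suc s)" .
    show "real (j choose Suc s) * fact s * (-1) ^ s * g (j - s) =
        (N - real j) * (real (j choose Suc s) * fact s * (-1) ^ s * g (j - Suc s)) + h s"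
      unfolding gs by (simp add: h_def algebra_simps)
  qed simp
  also have "\<dots> = (N - real j) * leibniz_log_coeff g j + (\<Sum>s<j. h s)"
    unfolding leibniz_log_coeff_binomial sum.distrib sum_distrib_left ..
  finally show ?thesis by simp
qed

lemma has_vector_derivative_Ln_of_real:
  assumes "t \<noteq> 0"
  shows "((\<lambda>t. Ln (of_real t)) has_vector_derivative 1 / of_real t) (at t)"
proof (cases "t > 0")
  case True
  show ?thesis
  proof (rule has_vector_derivative_transform_within_open[where S = "{0<..}"])
    have "(ln has_real_derivative (1 / t)) (at t)"
      using True by (auto intro!: derivative_eq_intros)
    from has_vector_derivative_of_real[OF this, where 'a = complex]
    show "((\<lambda>t. of_real (ln t)) has_vector_derivative (1 / of_real t :: complex)) (at t)"
      by simp
  qed (use True in \<open>auto simp: Ln_of_real\<close>)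
next
  case False
  hence "t < 0" using assms by simp
  show ?thesis
  proof (rule has_vector_derivative_transform_within_open[where S = "{..<0}"])
    have "((\<lambda>t. ln (- t)) has_real_derivative (1 / t)) (at t)"
      using \<open>t < 0\<close> by (auto intro!: derivative_eq_intros simp: divide_simps)
    from has_vector_derivative_of_real[OF this, where 'a = complex]
    show "((\<lambda>t. of_real (ln (- t)) + of_real pi * \<i>) has_vector_derivative (1 / of_real t)) (at t)"
      by (subst has_vector_derivative_add_const) simp
  qed (use \<open>t < 0\<close> in \<open>auto simp: Ln_of_real'\<close>)
qed

lemma has_vector_derivative_powi_Ln:
  fixes k :: int
  assumes "t \<noteq> 0"
  shows "((\<lambda>t. of_real t powi k * (A * Ln (of_real t) + B)) has_vector_derivative
           of_real t powi (k - 1) * (of_int k * (A * Ln (of_real t) + B) + A)) (at t)"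
proof -
  have "((\<lambda>t. t powi k) has_real_derivative (of_int k * t powi (k - 1))) (at t)"
    using assms by (auto intro!: derivative_eq_intros)
  from has_vector_derivative_of_real[OF this, where 'a = complex]
  have 1: "((\<lambda>t. of_real t powi k) has_vector_derivative
               (of_int k * of_real t powi (k - 1) :: complex)) (at t)"
    by simp
  have 2: "((\<lambda>t. A * Ln (of_real t) + B) has_vector_derivative A * (1 / of_real t)) (at t)"
    using has_vector_derivative_mult_right[OF has_vector_derivative_Ln_of_real[OF assms]]
    by (subst has_vector_derivative_add_const)
  have "of_real t powi k = (of_real t powi (k - 1) * of_real t :: complex)"
    using assms power_int_minus_mult[of "of_real t :: complex" k] by simp
  thus ?thesis
    using has_vector_derivative_mult[OF 1 2] assms by (simp add: algebra_simps)
qed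

text \<open>
  Writing the falling factorial \<open>N (N - 1) \<dots> (N - i + 1)\<close> as \<open>N! / \<Gamma>(N - i + 1)\<close> covers \<open>i > N\<close>
  as well: the derivatives of \<open>t^N\<close> then vanish, and so does the reciprocal Gamma function at
  the non-positive integer \<open>N - i + 1\<close>.
\<close>

lemma nth_vector_derivative_power_Ln:
  fixes N j :: nat
  defines "g \<equiv> \<lambda>i. rGamma (real N - real i + 1)"
  assumes "t \<noteq> 0"
  shows "nth_vector_derivative j (\<lambda>t. of_real t ^ N * Ln (of_real t)) t =
           of_real t powi (int N - int j) *
             (of_real (fact N * g j) * Ln (of_real t) + of_real (fact N * leibniz_log_coeff g j))"
  using assms(2)
proof (induction j arbitrary: t)
  case 0
  have "fact N * g 0 = 1"
    using Gamma_fact[of N, where 'a = real] by (simp add: g_def rGamma_inverse_Gamma add_ac)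
  thus ?case by (simp add: nth_vector_derivative_def leibniz_log_coeff_def)
next
  case (Suc j)
  let ?f = "\<lambda>t. of_real t ^ N * Ln (of_real t)"
  have g: "g (Suc i) = (real N - real i) * g i" for i
    using rGamma_plus1[of "real N - real i"] by (simp add: g_def algebra_simps)
  have "(nth_vector_derivative j ?f has_vector_derivative
           of_real t powi (int N - int j - 1) *
             (of_int (int N - int j) * (of_real (fact N * g j) * Ln (of_real t) + of_real (fact N * leibniz_log_coeff g j))
               + of_real (fact N * g j))) (at t)"
    by (rule has_vector_derivative_transform_within_open[OF has_vector_derivative_powi_Ln[OF Suc.prems]
          open_Compl[OF closed_singleton[of 0]]])
       (use Suc in auto)
  hence "vector_derivative (nth_vector_derivative j ?f) (at t) =
           of_real t powi (int N - int j - 1) *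
             (of_int (int N - int j) * (of_real (fact N * g j) * Ln (of_real t) + of_real (fact N * leibniz_log_coeff g j))
               + of_real (fact N * g j))"
    by (rule vector_derivative_at)
  moreover have "nth_vector_derivative (Suc j) ?f t = vector_derivative (nth_vector_derivative j ?f) (at t)"
    by (simp add: nth_vector_derivative_def)
  ultimately show ?case
    by (simp add: g leibniz_log_coeff_Suc[of g, OF g] algebra_simps diff_diff_eq)
qed

section \<open>The fractional integral and the Caputo derivative\<close>

theorem theorem15:
  fixes \<alpha> a x :: real and n m :: nat
  assumes "\<alpha> > 0" and "\<alpha> \<notin> \<int>" and "m = nat \<lceil>\<alpha>\<rceil>"
    and "a \<noteq> 0" and "x > a" and "x \<noteq> 0"
  shows "(summable (F21_term \<alpha> (\<alpha> + 2 * n + 1) (\<alpha> + 1) ((a - x) / a)) \<longrightarrow>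
          summable (Psi_term \<alpha> (\<alpha> + 2 * n + 1) a x) \<longrightarrow>
          RL_integral \<alpha> a (\<lambda>t. of_real t ^ (2 * n) * Ln (of_real t)) x =
            of_real x powr of_real (2 * n + \<alpha>) * of_real ((x - a) powr \<alpha>) /
              (of_real a powr of_real \<alpha> * of_real (Gamma (1 + \<alpha>))) *
            (of_real (F21 \<alpha> (\<alpha> + 2 * n + 1) (\<alpha> + 1) ((a - x) / a)) *
               (Ln (of_real x) - of_real (Digamma (\<alpha> + 2 * n + 1))) +
             of_real (\<alpha> * (\<Sum>k. Psi_term \<alpha> (\<alpha> + 2 * n + 1) a x k))))
       \<and>
         (summable (F21_term (m - \<alpha>) (2 * n - \<alpha> + 1) (m - \<alpha> + 1) ((a - x) / a)) \<longrightarrow>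
          summable (Psi_term (m - \<alpha>) (2 * n - \<alpha> + 1) a x) \<longrightarrow>
          Caputo_derivative \<alpha> a (\<lambda>t. of_real t ^ (2 * n) * Ln (of_real t)) x =
            of_real (Gamma (2 * n + 1)) *
              of_real x powr of_real (2 * n - \<alpha>) * of_real ((x - a) powr (m - \<alpha>)) /
              (of_real a powr of_real (m - \<alpha>) * of_real (Gamma (1 + m - \<alpha>))) *
            (of_real (F21 (m - \<alpha>) (2 * n - \<alpha> + 1) (m - \<alpha> + 1) ((a - x) / a)) *
               ((Ln (of_real x) - of_real (Digamma (2 * n - \<alpha> + 1))) *
                  of_real (rGamma (2 * real n - m + 1)) +
                of_real (fact m * (\<Sum>r = 1..m. (-1) ^ (r - 1) / (r * fact (m - r)) *
                                     rGamma (2 * real n - m + r + 1)))) +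
             of_real ((m - \<alpha>) * rGamma (2 * real n - m + 1) *
                      (\<Sum>k. Psi_term (m - \<alpha>) (2 * n - \<alpha> + 1) a x k))))"
proof (intro conjI impI)
  have Ints: "c \<notin> \<int>\<^sub>\<le>\<^sub>0" if "c = \<alpha> + of_int i \<or> c = of_int i - \<alpha>" for c i
  proof
    assume "c \<in> \<int>\<^sub>\<le>\<^sub>0"
    hence "c \<in> \<int>" using nonpos_Ints_subset_Ints by blast
    moreover have "\<alpha> = c - of_int i \<or> \<alpha> = of_int i - c" using that by auto
    ultimately have "\<alpha> \<in> \<int>" by auto
    thus False using assms(2) by simp
  qed
  \<comment> \<open>For \<open>a < 0 < x\<close> one has \<open>z = 1 + x / \<bar>a\<bar> > 1\<close>, and \<open>x = 0\<close> is excluded.\<close>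
  have ax: "a * x > 0" if "\<bar>(a - x) / a\<bar> \<le> 1"
    using that assms(4-6) by (cases "a > 0") (auto simp: zero_less_mult_iff field_simps)
  {
    let ?c = "\<alpha> + real (2 * n) + 1" and ?z = "(a - x) / a"
    assume F: "summable (F21_term \<alpha> ?c (\<alpha> + 1) ?z)" and P: "summable (Psi_term \<alpha> ?c a x)"
    have c0: "?c \<notin> \<int>\<^sub>\<le>\<^sub>0" using Ints[of ?c "int (2 * n + 1)"] by simp
    have z: "\<bar>?z\<bar> \<le> 1"
      by (rule summable_F21_term_imp_abs_le_1[OF _ _ _ F])
         (use Ints[of \<alpha> 0] c0 Ints[of "\<alpha> + 1" 1] in simp_all)
    have "((\<lambda>t. of_real ((x - t) powr (\<alpha> - 1)) *
              (of_real t powi int (2 * n) * (1 * Ln (of_real t) + 0))) has_integral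
           of_real x powr of_real (of_int (int (2 * n)) + \<alpha>) * of_real ((x - a) powr \<alpha>) /
             (of_real a powr of_real \<alpha> * of_real \<alpha>) *
             (of_real (F21 \<alpha> ?c (\<alpha> + 1) ?z) * (1 * (Ln (of_real x) - of_real (Digamma ?c)) + 0) +
              1 * of_real (\<alpha> * (\<Sum>k. Psi_term \<alpha> ?c a x k)))) {a..x}"
      by (rule has_integral_kernel_powi_Ln[OF assms(1) assms(5) ax[OF z] z c0 F P]) simp
    hence "integral {a..x} (\<lambda>t. of_real ((x - t) powr (\<alpha> - 1)) * (of_real t ^ (2 * n) * Ln (of_real t))) =
           of_real x powr of_real (2 * n + \<alpha>) * of_real ((x - a) powr \<alpha>) /
             (of_real a powr of_real \<alpha> * of_real \<alpha>) *
             (of_real (F21 \<alpha> ?c (\<alpha> + 1) ?z) * (Ln (of_real x) - of_real (Digamma ?c)) +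
              of_real (\<alpha> * (\<Sum>k. Psi_term \<alpha> ?c a x k)))"
      unfolding power_int_of_nat mult_1 add_0_right by (subst integral_unique) auto
    moreover have "Gamma (1 + \<alpha>) = \<alpha> * Gamma \<alpha>"
      using Gamma_plus1[of \<alpha>] Ints[of \<alpha> 0] by (simp add: add.commute)
    ultimately show "RL_integral \<alpha> a (\<lambda>t. of_real t ^ (2 * n) * Ln (of_real t)) x =
            of_real x powr of_real (2 * n + \<alpha>) * of_real ((x - a) powr \<alpha>) /
              (of_real a powr of_real \<alpha> * of_real (Gamma (1 + \<alpha>))) *
            (of_real (F21 \<alpha> (\<alpha> + 2 * n + 1) (\<alpha> + 1) ((a - x) / a)) *
               (Ln (of_real x) - of_real (Digamma (\<alpha> + 2 * n + 1))) +
             of_real (\<alpha> * (\<Sum>k. Psi_term \<alpha> (\<alpha> + 2 * n + 1) a x k)))"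
      unfolding RL_integral_def by (simp add: divide_inverse mult_ac)
  }
  {
    let ?b = "real m - \<alpha>" and ?c = "real (2 * n) - \<alpha> + 1" and ?z = "(a - x) / a"
    assume F: "summable (F21_term ?b ?c (?b + 1) ?z)" and P: "summable (Psi_term ?b ?c a x)"
    let ?g = "\<lambda>i. rGamma (real (2 * n) - real i + 1)"
    let ?u = "of_real (fact (2 * n) * ?g m) :: complex"
    let ?v = "of_real (fact (2 * n) * leibniz_log_coeff ?g m) :: complex"
    have "\<alpha> \<noteq> real m" using assms(2) by auto
    moreover have "\<alpha> \<le> real m" using assms(3) by linarith
    ultimately have b: "?b > 0" by simp
    have c0: "?c \<notin> \<int>\<^sub>\<le>\<^sub>0" using Ints[of ?c "int (2 * n + 1)"] by simp
    have z: "\<bar>?z\<bar> \<le> 1"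
      by (rule summable_F21_term_imp_abs_le_1[OF _ _ _ F])
         (use Ints[of ?b m] c0 Ints[of "?b + 1" "int m + 1"] in simp_all)
    note ax = ax[OF z]
    have I: "((\<lambda>t. of_real ((x - t) powr (?b - 1)) *
              (of_real t powi (int (2 * n) - int m) * (?u * Ln (of_real t) + ?v))) has_integral
           of_real x powr of_real (of_int (int (2 * n) - int m) + ?b) * of_real ((x - a) powr ?b) /
             (of_real a powr of_real ?b * of_real ?b) *
             (of_real (F21 ?b ?c (?b + 1) ?z) * (?u * (Ln (of_real x) - of_real (Digamma ?c)) + ?v) +
              ?u * of_real (?b * (\<Sum>k. Psi_term ?b ?c a x k)))) {a..x}"
      by (rule has_integral_kernel_powi_Ln[OF b assms(5) ax z c0 F P]) simp
    have D: "of_real t powi (int (2 * n) - int m) * (?u * Ln (of_real t) + ?v) =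
        nth_vector_derivative m (\<lambda>t. of_real t ^ (2 * n) * Ln (of_real t)) t" if "t \<in> {a..x}" for t
    proof -
      have "t \<noteq> 0" using that ax by (auto simp: zero_less_mult_iff)
      from nth_vector_derivative_power_Ln[OF this, of m "2 * n"] show ?thesis ..
    qed
    have "((\<lambda>t. of_real ((x - t) powr (?b - 1)) *
              nth_vector_derivative m (\<lambda>t. of_real t ^ (2 * n) * Ln (of_real t)) t) has_integral
           of_real x powr of_real (of_int (int (2 * n) - int m) + ?b) * of_real ((x - a) powr ?b) /
             (of_real a powr of_real ?b * of_real ?b) *
             (of_real (F21 ?b ?c (?b + 1) ?z) * (?u * (Ln (of_real x) - of_real (Digamma ?c)) + ?v) +
              ?u * of_real (?b * (\<Sum>k. Psi_term ?b ?c a x k)))) {a..x}"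
      by (rule has_integral_eq[OF _ I]) (simp only: D)
    hence "Caputo_derivative \<alpha> a (\<lambda>t. of_real t ^ (2 * n) * Ln (of_real t)) x =
        1 / of_real (Gamma ?b) *
          (of_real x powr of_real (of_int (int (2 * n) - int m) + ?b) * of_real ((x - a) powr ?b) /
             (of_real a powr of_real ?b * of_real ?b) *
             (of_real (F21 ?b ?c (?b + 1) ?z) * (?u * (Ln (of_real x) - of_real (Digamma ?c)) + ?v) +
              ?u * of_real (?b * (\<Sum>k. Psi_term ?b ?c a x k))))"
      unfolding Caputo_derivative_def Let_def assms(3)[symmetric] by (subst integral_unique) auto
    also have "real_of_int (int (2 * n) - int m) + ?b = real (2 * n) - \<alpha>" by simp
    also have "?u = of_real (Gamma (2 * n + 1)) * of_real (rGamma (2 * real n - m + 1))"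
      using Gamma_fact[of "2 * n", where 'a = real] by (simp add: add.commute)
    also have "?v = of_real (Gamma (2 * n + 1)) * of_real (fact m * (\<Sum>r = 1..m. (-1) ^ (r - 1) / (r * fact (m - r)) *
                                     rGamma (2 * real n - m + r + 1)))"
    proof -
      have "leibniz_log_coeff ?g m = fact m * (\<Sum>r = 1..m. (-1) ^ (r - 1) / (r * fact (m - r)) *
                                     rGamma (2 * real n - m + r + 1))"
        unfolding leibniz_log_coeff_def sum_distrib_left
        by (rule sum.cong) (simp_all add: of_nat_diff algebra_simps)
      thus ?thesis
        using Gamma_fact[of "2 * n", where 'a = real] by (simp only: of_real_mult) (simp add: add.commute)
    qed
    \<comment> \<open>The two sides differ by a rearrangement of factors; abstracting the factors to variables keeps
       sums such as \<open>m - \<alpha>\<close> inside them from being multiplied out.\<close>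
    also have "1 / G * (X * Y / (A * B) * (F * (C * R * L + C * V) + C * R * of_real (?b * S))) =
                 C * X * Y / (A * (B * G)) * (F * (L * R + V) + of_real ?b * R * of_real S)"
      for G X Y A B F C R L V :: complex and S :: real
      by (simp add: divide_inverse algebra_simps)
    also have "of_real ?b * of_real (Gamma ?b) = (of_real (Gamma (1 + m - \<alpha>)) :: complex)"
    proof -
      have "?b * Gamma ?b = Gamma (1 + m - \<alpha>)"
        using Gamma_plus1[of ?b] Ints[of ?b m] by (simp add: algebra_simps)
      thus ?thesis by (simp only: of_real_mult[symmetric])
    qed
    finally show "Caputo_derivative \<alpha> a (\<lambda>t. of_real t ^ (2 * n) * Ln (of_real t)) x =
            of_real (Gamma (2 * n + 1)) *
              of_real x powr of_real (2 * n - \<alpha>) * of_real ((x - a) powr (m - \<alpha>)) /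
              (of_real a powr of_real (m - \<alpha>) * of_real (Gamma (1 + m - \<alpha>))) *
            (of_real (F21 (m - \<alpha>) (2 * n - \<alpha> + 1) (m - \<alpha> + 1) ((a - x) / a)) *
               ((Ln (of_real x) - of_real (Digamma (2 * n - \<alpha> + 1))) *
                  of_real (rGamma (2 * real n - m + 1)) +
                of_real (fact m * (\<Sum>r = 1..m. (-1) ^ (r - 1) / (r * fact (m - r)) *
                                     rGamma (2 * real n - m + r + 1)))) +
             of_real ((m - \<alpha>) * rGamma (2 * real n - m + 1) *
                      (\<Sum>k. Psi_term (m - \<alpha>) (2 * n - \<alpha> + 1) a x k)))"
      by (simp only: of_real_mult)
  }
qed

end
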